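(* Let $\mathcal{H}$ be a complex Hilbert space and let $S,T\in\mathcal{B}(\mathcal{H})$. Then $$dw(S+T)\leq dw(S)+dw(T)+w(S^*T+T^*S).$$
   Context: $\mathcal{B}(\mathcal{H})$ is the algebra of bounded linear operators on the complex Hilbert space $\mathcal{H}$. For $T\in\mathcal{B}(\mathcal{H})$, the numerical radius is $w(T)=\sup\{|\langle Tx,x\rangle|: x\in\mathcal{H},\|x\|=1\}$ and the Davis-Wielandt radius is $dw(T)=\sup\{\sqrt{|\langle Tx,x\rangle|^2+\|Tx\|^4}: x\in\mathcal{H},\|x\|=1\}$. *)

theory Defs
  imports Complex_Main
begin

class complex_vector = real_vector +
  fixes scaleC :: "complex \<Rightarrow> 'a \<Rightarrow> 'a"  (infixr \<open>*\<^sub>C\<close> 75)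
  assumes scaleC_add_right: "c *\<^sub>C (x + y) = c *\<^sub>C x + c *\<^sub>C y"
    and scaleC_add_left: "(c + d) *\<^sub>C x = c *\<^sub>C x + d *\<^sub>C x"
    and scaleC_scaleC: "c *\<^sub>C (d *\<^sub>C x) = (c * d) *\<^sub>C x"
    and scaleC_one: "1 *\<^sub>C x = x"
    and scaleR_scaleC: "r *\<^sub>R x = complex_of_real r *\<^sub>C x"

text \<open>The inner product is linear in its first argument. The order on complex numbers is not
  used: that \<open>cinner x x\<close> is real follows from \<open>cinner_commute\<close>. Building on
  \<^class>\<open>real_normed_vector\<close> supplies the metric and topology of the norm; its triangle
  inequality is redundant here, being a consequence of Cauchy-Schwarz.\<close>

class complex_inner = complex_vector + real_normed_vector +
  fixes cinner :: "'a \<Rightarrow> 'a \<Rightarrow> complex"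
  assumes cinner_commute: "cinner x y = cnj (cinner y x)"
    and cinner_add_left: "cinner (x + y) z = cinner x z + cinner y z"
    and cinner_scaleC_left: "cinner (c *\<^sub>C x) y = c * cinner x y"
    and cinner_ge_zero: "0 \<le> Re (cinner x x)"
    and cinner_eq_zero_iff: "cinner x x = 0 \<longleftrightarrow> x = 0"
    and norm_eq_sqrt_cinner: "norm x = sqrt (Re (cinner x x))"

class chilbert_space = complex_inner + complete_space

definition bounded_clinear ::
    "('a::{complex_vector,real_normed_vector} \<Rightarrow> 'b::{complex_vector,real_normed_vector}) \<Rightarrow> bool"
  where "bounded_clinear T \<longleftrightarrow> bounded_linear T \<and> (\<forall>c x. T (c *\<^sub>C x) = c *\<^sub>C T x)"

definition cadjoint :: "('a::complex_inner \<Rightarrow> 'b::complex_inner) \<Rightarrow> 'b \<Rightarrow> 'a"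
  where "cadjoint T = (THE T'. \<forall>x y. cinner (T x) y = cinner x (T' y))"

text \<open>On \<^typ>\<open>real\<close> the value of \<open>Sup {}\<close> is unspecified. The suprema below are of nonnegative
  numbers, so on the zero space, which has no unit vectors, they are taken to be 0.\<close>

definition sup_nonneg :: "real set \<Rightarrow> real"
  where "sup_nonneg A = (if A = {} then 0 else Sup A)"

definition numerical_radius :: "('a::complex_inner \<Rightarrow> 'a) \<Rightarrow> real"
  where "numerical_radius T = sup_nonneg {cmod (cinner (T x) x) | x. norm x = 1}"

definition davis_wielandt_radius :: "('a::complex_inner \<Rightarrow> 'a) \<Rightarrow> real"
  where "davis_wielandt_radius T =
    sup_nonneg {sqrt ((cmod (cinner (T x) x))\<^sup>2 + norm (T x) ^ 4) | x. norm x = 1}"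

instantiation complex :: chilbert_space
begin

definition "scaleC_complex c x = c * x" for c x :: complex
definition "cinner_complex x y = x * cnj y" for x y :: complex

instance
proof
qed (simp_all add: scaleC_complex_def cinner_complex_def algebra_simps scaleR_conv_of_real
    cmod_def power2_eq_square)

end

end

theory Submission
  imports Defs
begin

text \<open>For a unit vector \<open>x\<close>, \<open>\<parallel>(S + T)x\<parallel>\<^sup>2 = \<parallel>Sx\<parallel>\<^sup>2 + \<parallel>Tx\<parallel>\<^sup>2 + \<langle>(S\<^sup>*T + T\<^sup>*S)x, x\<rangle>\<close>. Hence the
  pair \<open>(\<langle>(S + T)x, x\<rangle>, \<parallel>(S + T)x\<parallel>\<^sup>2)\<close> is the sum of the corresponding pairs for \<open>S\<close> and \<open>T\<close> and of
  \<open>(0, \<langle>(S\<^sup>*T + T\<^sup>*S)x, x\<rangle>)\<close>, and the triangle inequality of the Euclidean norm applies. The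
  adjoints exist by the Riesz representation theorem, where the representing vector of a
  functional \<open>f\<close> is the minimizer of \<open>\<parallel>x\<parallel>\<^sup>2 - 2 Re (f x)\<close>.\<close>

section \<open>Inner product calculus and Cauchy-Schwarz\<close>

lemma cinner_add_right: "cinner x (y + z) = cinner x y + cinner (x::'a::complex_inner) z"
  by (metis cinner_add_left cinner_commute complex_cnj_add)

lemma cinner_scaleC_right: "cinner x (c *\<^sub>C y) = cnj c * cinner (x::'a::complex_inner) y"
  by (metis cinner_commute cinner_scaleC_left complex_cnj_mult)

lemma cinner_scaleR_left: "cinner (r *\<^sub>R x) y = r * cinner (x::'a::complex_inner) y"
  by (simp add: scaleR_scaleC cinner_scaleC_left)

lemma cinner_scaleR_right: "cinner x (r *\<^sub>R y) = r * cinner (x::'a::complex_inner) y"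
  by (simp add: scaleR_scaleC cinner_scaleC_right)

lemma cinner_diff_right: "cinner x (y - z) = cinner x y - cinner (x::'a::complex_inner) z"
  using cinner_add_right[of x "y - z" z] by simp

lemma cinner_self_eq_norm: "cinner x x = of_real ((norm (x::'a::complex_inner))\<^sup>2)"
proof -
  have "Im (cinner x x) = 0"
    using cinner_commute[of x x] by (metis complex_cnj_cancel_iff Reals_cnj_iff complex_is_Real_iff)
  then show ?thesis
    by (simp add: complex_eq_iff norm_eq_sqrt_cinner cinner_ge_zero)
qed

lemma norm_add_sq:
  "(norm (x + y))\<^sup>2 = (norm x)\<^sup>2 + (norm y)\<^sup>2 + 2 * Re (cinner x (y::'a::complex_inner))"
proof -
  have "Re (cinner y x) = Re (cinner x y)"
    by (subst cinner_commute) simp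
  moreover have "Re (cinner (x + y) (x + y))
      = Re (cinner x x) + Re (cinner y y) + Re (cinner x y) + Re (cinner y x)"
    by (simp add: cinner_add_left cinner_add_right)
  ultimately show ?thesis
    by (simp add: cinner_self_eq_norm)
qed

text \<open>Squaring the triangle inequality of the norm bounds the real part; multiplying
  \<open>x\<close> by a phase then turns the modulus into a real part.\<close>

lemma cmod_cinner_le: "cmod (cinner x y) \<le> norm x * norm (y::'a::complex_inner)"
proof -
  have re: "Re (cinner u v) \<le> norm u * norm v" for u v :: 'a
  proof -
    have "(norm (u + v))\<^sup>2 \<le> (norm u + norm v)\<^sup>2"
      by (intro power_mono norm_triangle_ineq) simp
    then show ?thesis
      by (simp add: norm_add_sq power2_sum)
  qed
  \<comment> \<open>The conjugate phase of \<open>cinner x y\<close>. It is 0 if the product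
    vanishes, so only \<open>cmod c \<le> 1\<close> holds in general.\<close>
  define c where "c = cnj (sgn (cinner x y))"
  have c: "c * cinner x y = cmod (cinner x y)"
    using complex_norm_square[of "cinner x y"]
    by (cases "cinner x y = 0") (simp_all add: c_def sgn_eq power2_eq_square field_simps)
  have "cmod c \<le> 1"
    by (simp add: c_def norm_sgn)
  have "(norm (c *\<^sub>C x))\<^sup>2 = (cmod c * norm x)\<^sup>2"
  proof -
    have "cinner (c *\<^sub>C x) (c *\<^sub>C x) = (c * cnj c) * cinner x x"
      by (simp add: cinner_scaleC_left cinner_scaleC_right)
    then have "complex_of_real ((norm (c *\<^sub>C x))\<^sup>2) = of_real ((cmod c * norm x)\<^sup>2)"
      by (simp only: cinner_self_eq_norm power_mult_distrib of_real_mult flip: complex_norm_square)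
    then show ?thesis
      by (simp only: of_real_eq_iff)
  qed
  then have "norm (c *\<^sub>C x) = cmod c * norm x"
    by simp
  with \<open>cmod c \<le> 1\<close> have "norm (c *\<^sub>C x) \<le> norm x"
    by (simp add: mult_left_le_one_le)
  have "cmod (cinner x y) = Re (cinner (c *\<^sub>C x) y)"
    by (simp add: cinner_scaleC_left c)
  also have "\<dots> \<le> norm (c *\<^sub>C x) * norm y"
    by (rule re)
  also have "\<dots> \<le> norm x * norm y"
    using \<open>norm (c *\<^sub>C x) \<le> norm x\<close> by (simp add: mult_right_mono)
  finally show ?thesis .
qed

section \<open>Riesz representation by minimization\<close>

lemma parallelogram_midpoint:
  "4 * (norm ((1/2) *\<^sub>R (u + v)))\<^sup>2 + (norm (u - v))\<^sup>2
    = 2 * (norm u)\<^sup>2 + 2 * (norm (v::'a::complex_inner))\<^sup>2"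
proof -
  have "cinner u (- v) = - cinner u v"
    using cinner_diff_right[of u 0 v] cinner_scaleR_right[of u 0 0] by simp
  then show ?thesis
    using norm_add_sq[of u v] norm_add_sq[of u "- v"]
    by (simp add: power_divide add_divide_distrib del: scaleR_add_right)
qed

lemma riesz_real:
  fixes f :: "'a::chilbert_space \<Rightarrow> real"
  assumes "bounded_linear f"
  obtains z where "\<And>x. Re (cinner z x) = f x"
proof -
  interpret f: bounded_linear f by fact
  \<comment> \<open>If \<open>z\<close> represents \<open>f\<close>, then \<phi> x is the squared
    distance from x to z minus the constant \<open>(norm z)\<^sup>2\<close>, so z is found as the
    minimizer.\<close>
  define \<phi> where "\<phi> x = (norm x)\<^sup>2 - 2 * f x" for x
  obtain K where K: "\<And>x. \<bar>f x\<bar> \<le> norm x * K"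
    using f.bounded by auto
  have low: "\<phi> x \<ge> - (K\<^sup>2)" for x
  proof -
    have "0 \<le> (norm x - K)\<^sup>2" by simp
    then show ?thesis
      using K[of x] by (simp add: \<phi>_def power2_diff)
  qed
  then have bdd: "bdd_below (range \<phi>)"
    by (meson bdd_below.I2)
  define m where "m = Inf (range \<phi>)"
  have m: "m \<le> \<phi> x" for x
    unfolding m_def by (rule cInf_lower) (auto simp: bdd)
  have "\<exists>x. \<phi> x < m + inverse (real (Suc n))" for n
    using cInf_lessD[of "range \<phi>" "m + inverse (real (Suc n))"] by (auto simp: m_def)
  then obtain u where u: "\<And>n. \<phi> (u n) < m + inverse (real (Suc n))"
    by metis
  \<comment> \<open>In the parallelogram law the linear terms of \<phi> cancel, and \<phi> is at
    least \<open>m\<close> at the midpoint. Hence minimizing sequences are Cauchy.\<close>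
  have close: "(norm (v - w))\<^sup>2 \<le> 2 * (\<phi> v - m) + 2 * (\<phi> w - m)" for v w
  proof -
    have "\<phi> ((1/2) *\<^sub>R (v + w)) = (norm ((1/2) *\<^sub>R (v + w)))\<^sup>2 - (f v + f w)"
      by (simp add: \<phi>_def f.scaleR f.add add_divide_distrib del: scaleR_add_right)
    then show ?thesis
      using m[of "(1/2) *\<^sub>R (v + w)"] parallelogram_midpoint[of v w] \<phi>_def[of v] \<phi>_def[of w]
      by argo
  qed
  have "Cauchy u"
  proof (rule CauchyI)
    fix e :: real assume "0 < e"
    then obtain N where N: "inverse (real (Suc N)) < e\<^sup>2 / 4"
      using reals_Archimedean[of "e\<^sup>2 / 4"] by auto
    have "norm (u i - u j) < e" if "i \<ge> N" "j \<ge> N" for i j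
    proof -
      have "inverse (real (Suc i)) \<le> inverse (real (Suc N))"
        "inverse (real (Suc j)) \<le> inverse (real (Suc N))"
        using that by (auto intro!: le_imp_inverse_le)
      then have "(norm (u i - u j))\<^sup>2 < e\<^sup>2"
        using close[of "u i" "u j"] u[of i] u[of j] N by argo
      then show ?thesis
        using \<open>0 < e\<close> by (simp add: power2_less_imp_less)
    qed
    then show "\<exists>M. \<forall>i\<ge>M. \<forall>j\<ge>M. norm (u i - u j) < e"
      by blast
  qed
  then obtain z where z: "u \<longlonglongrightarrow> z"
    using Cauchy_convergent_iff convergent_def by blast
  have "\<phi> z \<le> m"
  proof (rule LIMSEQ_le)
    show "(\<lambda>n. \<phi> (u n)) \<longlonglongrightarrow> \<phi> z"
      unfolding \<phi>_def by (intro tendsto_intros z f.tendsto)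
    show "(\<lambda>n. m + inverse (real (Suc n))) \<longlonglongrightarrow> m"
      using tendsto_add[OF tendsto_const LIMSEQ_inverse_real_of_nat, of m] by simp
    show "\<exists>N. \<forall>n\<ge>N. \<phi> (u n) \<le> m + inverse (real (Suc n))"
      using u less_imp_le by blast
  qed
  have "Re (cinner z h) = f h" for h
  proof -
    \<comment> \<open>First variation: minimality along the line through \<open>z\<close> in
      direction \<open>h\<close> makes a quadratic in \<open>t\<close> nonnegative, which forces its
      linear coefficient to vanish.\<close>
    define a d where "a = (norm h)\<^sup>2" and "d = Re (cinner z h) - f h"
    have *: "0 \<le> t\<^sup>2 * a + 2 * t * d" for t
    proof -
      have "\<phi> z \<le> \<phi> (z + t *\<^sub>R h)"
        using \<open>\<phi> z \<le> m\<close> m[of "z + t *\<^sub>R h"] by linarith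
      then show ?thesis
        unfolding \<phi>_def f.add f.scaleR norm_add_sq
        by (simp add: a_def d_def cinner_scaleR_right power_mult_distrib algebra_simps)
    qed
    have "a \<ge> 0"
      by (simp add: a_def)
    \<comment> \<open>Dividing by \<open>a + 1\<close> instead of \<open>a\<close> covers
      \<open>h = 0\<close>. Substituting for \<open>d\<close> turns the quadratic into
      \<open>- t\<^sup>2 * (a + 2)\<close>.\<close>
    define t where "t = - d / (a + 1)"
    have d: "d = - (t * (a + 1))"
      using \<open>a \<ge> 0\<close> by (simp add: t_def field_simps)
    have "t\<^sup>2 * (a + 2) \<le> 0"
      using *[of t] unfolding d by (simp add: power2_eq_square algebra_simps)
    then have "t = 0"
      using \<open>a \<ge> 0\<close> by (simp add: mult_le_0_iff)
    then show ?thesis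
      using d by (simp add: d_def)
  qed
  then show thesis
    by (rule that)
qed

section \<open>Existence and uniqueness of adjoints\<close>

lemma bounded_linear_cinner_left:
  "bounded_linear (\<lambda>x. cinner x (y::'a::complex_inner))"
proof (rule bounded_linear_intro)
  show "norm (cinner x y) \<le> norm x * norm y" for x
    by (rule cmod_cinner_le)
qed (simp_all add: cinner_add_left cinner_scaleR_left scaleR_conv_of_real)

lemma cinner_cadjoint:
  fixes T :: "'a::chilbert_space \<Rightarrow> 'b::complex_inner"
  assumes "bounded_clinear T"
  shows "cinner (T x) y = cinner x (cadjoint T y)"
proof -
  have lin: "bounded_linear T" and clin: "\<And>c x. T (c *\<^sub>C x) = c *\<^sub>C T x"
    using assms by (auto simp: bounded_clinear_def)
  have "\<exists>z. \<forall>x. cinner (T x) y = cinner x z" for y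
  proof -
    have "bounded_linear (\<lambda>x. Re (cinner (T x) y))"
      by (rule bounded_linear_compose[OF bounded_linear_Re
            bounded_linear_compose[OF bounded_linear_cinner_left lin]])
    then obtain z where "\<And>x. Re (cinner z x) = Re (cinner (T x) y)"
      by (rule riesz_real) auto
    then have re: "Re (cinner x z) = Re (cinner (T x) y)" for x
      by (metis cinner_commute complex_cnj(1) complex.sel(1) complex.collapse)
    \<comment> \<open>Complex linearity recovers the imaginary part: it is minus the real part at
      \<open>\<i> *\<^sub>C x\<close>.\<close>
    have "Im (cinner x z) = Im (cinner (T x) y)" for x
      using re[of "\<i> *\<^sub>C x"] by (simp add: clin cinner_scaleC_left)
    with re show ?thesis
      by (metis complex_eqI)
  qed
  then obtain T' where T': "\<And>x y. cinner (T x) y = cinner x (T' y)"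
    by metis
  have "cadjoint T = T'"
    unfolding cadjoint_def
  proof (rule the_equality)
    fix U assume U: "\<forall>x y. cinner (T x) y = cinner x (U y)"
    show "U = T'"
    proof
      fix y
      \<comment> \<open>The difference of two candidates is orthogonal to every vector, hence to
        itself.\<close>
      have "cinner (U y - T' y) (U y - T' y) = 0"
        using U T' by (simp add: cinner_diff_right)
      then show "U y = T' y"
        by (simp add: cinner_eq_zero_iff)
    qed
  qed (simp add: T')
  then show ?thesis
    by (simp add: T')
qed

lemma cinner_cadjoint_left:
  fixes T :: "'a::chilbert_space \<Rightarrow> 'b::complex_inner"
  assumes "bounded_clinear T"
  shows "cinner (cadjoint T y) x = cinner y (T x)"
  using cinner_cadjoint[OF assms] by (metis cinner_commute)

section \<open>Suprema over unit vectors\<close>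

lemma bounded_clinear_unit_bound:
  assumes "bounded_clinear T"
  obtains K where "\<And>x. norm x = 1 \<Longrightarrow> norm (T x) \<le> K"
  using assms bounded_linear.bounded[of T] unfolding bounded_clinear_def
  by (metis mult_1)

lemma sup_nonneg_upper:
  assumes "bdd_above A" and "a \<in> A"
  shows "a \<le> sup_nonneg A"
  using assms by (auto simp: sup_nonneg_def intro: cSup_upper)

lemma davis_wielandt_radius_upper:
  assumes "bounded_clinear T" and "norm x = 1"
  shows "sqrt ((cmod (cinner (T x) x))\<^sup>2 + norm (T x) ^ 4) \<le> davis_wielandt_radius T"
  unfolding davis_wielandt_radius_def
proof (rule sup_nonneg_upper)
  obtain K where K: "\<And>x. norm x = 1 \<Longrightarrow> norm (T x) \<le> K"
    using bounded_clinear_unit_bound[OF assms(1)] by blast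
  have "sqrt ((cmod (cinner (T x) x))\<^sup>2 + norm (T x) ^ 4) \<le> sqrt (K\<^sup>2 + K ^ 4)"
    if "norm x = 1" for x
    using K[OF that] cmod_cinner_le[of "T x" x] that
    by (intro real_sqrt_le_mono add_mono power_mono) auto
  then show "bdd_above {sqrt ((cmod (cinner (T x) x))\<^sup>2 + norm (T x) ^ 4) | x. norm x = 1}"
    by (intro bdd_aboveI[of _ "sqrt (K\<^sup>2 + K ^ 4)"]) blast
qed (use assms in blast)

text \<open>Assuming a bound on the quadratic form, not on \<open>T\<close>, lets this apply to
  \<open>S\<^sup>*T + T\<^sup>*S\<close> without proving that adjoints are bounded.\<close>

lemma numerical_radius_upper:
  assumes "\<And>x. norm x = 1 \<Longrightarrow> cmod (cinner (T x) x) \<le> K" and "norm x = 1"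
  shows "cmod (cinner (T x) x) \<le> numerical_radius T"
  unfolding numerical_radius_def
  by (rule sup_nonneg_upper) (use assms in \<open>auto intro!: bdd_aboveI[of _ K]\<close>)

lemma sqrt_norm_sq_add_le:
  fixes a b :: complex and p q r :: real
  shows "sqrt ((cmod (a + b))\<^sup>2 + (p + q + r)\<^sup>2)
    \<le> sqrt ((cmod a)\<^sup>2 + p\<^sup>2) + sqrt ((cmod b)\<^sup>2 + q\<^sup>2) + \<bar>r\<bar>"
proof -
  have tri: "sqrt ((cmod (u + v))\<^sup>2 + (s + t)\<^sup>2) \<le> sqrt ((cmod u)\<^sup>2 + s\<^sup>2) + sqrt ((cmod v)\<^sup>2 + t\<^sup>2)"
    for u v :: complex and s t :: real
  proof -
    \<comment> \<open>Passing to moduli reduces the claim to the triangle inequality in the real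
      plane.\<close>
    have "sqrt ((cmod (u + v))\<^sup>2 + (s + t)\<^sup>2) \<le> sqrt ((cmod u + cmod v)\<^sup>2 + (s + t)\<^sup>2)"
      by (intro real_sqrt_le_mono add_right_mono power_mono norm_triangle_ineq) simp
    also have "\<dots> \<le> sqrt ((cmod u)\<^sup>2 + s\<^sup>2) + sqrt ((cmod v)\<^sup>2 + t\<^sup>2)"
      by (rule real_sqrt_sum_squares_triangle_ineq)
    finally show ?thesis .
  qed
  show ?thesis
    \<comment> \<open>First \<open>(0, r)\<close> is split off, whose norm is
      \<open>\<bar>r\<bar>\<close>; then \<open>(a, p)\<close> is separated from
      \<open>(b, q)\<close>.\<close>
    using tri[of "a + b" 0 "p + q" r] tri[of a b p q] by simp
qed

theorem theorem2p23:
  fixes S T :: "'h::chilbert_space \<Rightarrow> 'h"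
  assumes "bounded_clinear S" and "bounded_clinear T"
  shows "davis_wielandt_radius (\<lambda>x. S x + T x)
    \<le> davis_wielandt_radius S + davis_wielandt_radius T
      + numerical_radius (\<lambda>x. cadjoint S (T x) + cadjoint T (S x))"
proof (cases "\<exists>x::'h. norm x = 1")
  case False
  \<comment> \<open>Without unit vectors all three radii are 0 by the convention in
    \<open>sup_nonneg\<close>.\<close>
  then show ?thesis
    by (simp add: davis_wielandt_radius_def numerical_radius_def sup_nonneg_def)
next
  case True
  let ?R = "\<lambda>x. cadjoint S (T x) + cadjoint T (S x)"
  obtain K where K: "\<And>x. norm x = 1 \<Longrightarrow> norm (S x) \<le> K"
    using bounded_clinear_unit_bound[OF assms(1)] by blast
  obtain L where L: "\<And>x. norm x = 1 \<Longrightarrow> norm (T x) \<le> L"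
    using bounded_clinear_unit_bound[OF assms(2)] by blast
  \<comment> \<open>Moving the adjoints across leaves an inner product plus its conjugate: exactly
    the cross term of \<open>norm_add_sq\<close>.\<close>
  have R: "cinner (?R x) x = of_real (2 * Re (cinner (S x) (T x)))" for x
  proof -
    have "cinner (?R x) x = cinner (S x) (T x) + cnj (cinner (S x) (T x))"
      using cinner_commute[of "T x" "S x"]
      by (simp add: cinner_add_left cinner_cadjoint_left assms)
    then show ?thesis
      by (simp only: complex_add_cnj)
  qed
  have "cmod (cinner (?R x) x) \<le> 2 * (K * L)" if "norm x = 1" for x
  proof -
    have "\<bar>Re (cinner (S x) (T x))\<bar> \<le> norm (S x) * norm (T x)"
      using abs_Re_le_cmod cmod_cinner_le order_trans by blast
    also have "\<dots> \<le> K * L"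
      using K[OF that] L[OF that] norm_ge_zero[of "S x"]
      by (intro mult_mono) (auto intro: order_trans[OF norm_ge_zero])
    finally show ?thesis
      unfolding R norm_of_real by (simp add: abs_mult)
  qed
  then have w: "cmod (cinner (?R x) x) \<le> numerical_radius ?R" if "norm x = 1" for x
    using that by (rule numerical_radius_upper)
  have "sqrt ((cmod (cinner (S x + T x) x))\<^sup>2 + norm (S x + T x) ^ 4)
      \<le> davis_wielandt_radius S + davis_wielandt_radius T + numerical_radius ?R"
    if x: "norm x = 1" for x
  proof -
    let ?r = "2 * Re (cinner (S x) (T x))"
    \<comment> \<open>Fourth powers become squares of squared norms, so that
      \<open>norm_add_sq\<close> splits the second coordinate.\<close>
    have four: "norm y ^ 4 = ((norm y)\<^sup>2)\<^sup>2" for y :: 'h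
      by (simp flip: power_mult)
    have "sqrt ((cmod (cinner (S x + T x) x))\<^sup>2 + norm (S x + T x) ^ 4)
        = sqrt ((cmod (cinner (S x) x + cinner (T x) x))\<^sup>2
            + ((norm (S x))\<^sup>2 + (norm (T x))\<^sup>2 + ?r)\<^sup>2)"
      by (simp only: four norm_add_sq cinner_add_left)
    also have "\<dots> \<le> sqrt ((cmod (cinner (S x) x))\<^sup>2 + norm (S x) ^ 4)
        + sqrt ((cmod (cinner (T x) x))\<^sup>2 + norm (T x) ^ 4) + \<bar>?r\<bar>"
      unfolding four by (rule sqrt_norm_sq_add_le)
    also have "\<bar>?r\<bar> = cmod (cinner (?R x) x)"
      by (simp only: R norm_of_real)
    finally show ?thesis
      using davis_wielandt_radius_upper[OF assms(1) x] davis_wielandt_radius_upper[OF assms(2) x]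
        w[OF x] by linarith
  qed
  then show ?thesis
    using True unfolding davis_wielandt_radius_def[of "\<lambda>x. S x + T x"] sup_nonneg_def
    by (auto intro!: cSup_least)
qed

end
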